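(* Axiom (D6) can fail in the completion $\Gamma_D[\mathcal A]$ of an ordered domain algebra $\mathcal A$: if $\mathcal A$ is the full proper ordered domain algebra over a base of two elements, then there are $A,B\in\Gamma_D[\mathcal A]$ such that $\mathbf{dom}_\gamma(A;_\gamma B)\neq\mathbf{dom}_\gamma(A;_\gamma\mathbf{dom}_\gamma(B))$.
   Context: The full proper ordered domain algebra over a base set $U$ has as elements all binary relations on $U$, ordered by $\subseteq$, with $x;y=\{(u,v):\exists w\,(u,w)\in x,(w,v)\in y\}$, $\mathbf{dom}(x)=\{(u,u):\exists v\,(u,v)\in x\}$, $\mathbf{ran}(x)=\{(v,v):\exists u\,(u,v)\in x\}$, $x^\smile=\{(v,u):(u,v)\in x\}$, $0=\emptyset$, $\mathbf{id}=\{(u,u):u\in U\}$. It is an ordered domain algebra; in particular it satisfies (D6): $\mathbf{dom}(a;b)=\mathbf{dom}(a;\mathbf{dom}(b))$. For an ordered domain algebra $\mathcal A$ with underlying poset $(P,\leq)$ and $S\subseteq P$ put $S^\uparrow=\{p\in P:\exists s\in S,\ s\leq p\}$. An up-set $X$ of $P$ ($\emptyset$ allowed) is $\Gamma_D$-closed if $\{\mathbf{dom}(x);y;\mathbf{ran}(z):x,y,z\in X\}^\uparrow=X$, and $\Gamma_D(X)$ is the smallest $\Gamma_D$-closed up-set containing the up-set $X$. $\Gamma_D[\mathcal A]$ is the set of $\Gamma_D$-closed up-sets ordered by reverse inclusion, with operations $C;_\gamma D=\Gamma_D(\{c;d:c\in C,d\in D\}^\uparrow)$ and $\mathbf{dom}_\gamma(C)=\Gamma_D(\{\mathbf{dom}(c):c\in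 C\}^\uparrow)$. *)

theory Defs
  imports Main HOL.Hull
begin

record 'p domain_structure =
  elems :: "'p set"
  leq :: "'p \<Rightarrow> 'p \<Rightarrow> bool"
  compose :: "'p \<Rightarrow> 'p \<Rightarrow> 'p"
  dom_op :: "'p \<Rightarrow> 'p"
  ran_op :: "'p \<Rightarrow> 'p"
  conv_op :: "'p \<Rightarrow> 'p"
  zero_el :: "'p"
  id_el :: "'p"

definition full_proper_oda :: "'u set \<Rightarrow> ('u \<times> 'u) set domain_structure" where
  "full_proper_oda U =
    \<lparr> elems = Pow (U \<times> U),
      leq = (\<subseteq>),
      compose = (O),
      dom_op = (\<lambda>x. Id_on (Domain x)),
      ran_op = (\<lambda>x. Id_on (Range x)),
      conv_op = converse,
      zero_el = {},
      id_el = Id_on U \<rparr>"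

definition up_closure :: "'p domain_structure \<Rightarrow> 'p set \<Rightarrow> 'p set" where
  "up_closure \<A> S = {p \<in> elems \<A>. \<exists>s\<in>S. leq \<A> s p}"

definition is_upset :: "'p domain_structure \<Rightarrow> 'p set \<Rightarrow> bool" where
  "is_upset \<A> X \<longleftrightarrow>
     X \<subseteq> elems \<A> \<and> (\<forall>x\<in>X. \<forall>p\<in>elems \<A>. leq \<A> x p \<longrightarrow> p \<in> X)"

definition GammaD_closed :: "'p domain_structure \<Rightarrow> 'p set \<Rightarrow> bool" where
  "GammaD_closed \<A> X \<longleftrightarrow>
     is_upset \<A> X \<and>
     up_closure \<A>
       {compose \<A> (compose \<A> (dom_op \<A> x) y) (ran_op \<A> z) | x y z.
          x \<in> X \<and> y \<in> X \<and> z \<in> X} = X"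

text \<open>The smallest closed up-set containing \<open>X\<close>, as an intersection; see
  \<open>GammaD_least_full\<close> below.\<close>

definition GammaD :: "'p domain_structure \<Rightarrow> 'p set \<Rightarrow> 'p set" where
  "GammaD \<A> X = GammaD_closed \<A> hull X"

definition completion :: "'p domain_structure \<Rightarrow> 'p set set" where
  "completion \<A> = {X. GammaD_closed \<A> X}"

definition comp_gamma :: "'p domain_structure \<Rightarrow> 'p set \<Rightarrow> 'p set \<Rightarrow> 'p set" where
  "comp_gamma \<A> C D =
     GammaD \<A> (up_closure \<A> {compose \<A> c d | c d. c \<in> C \<and> d \<in> D})"

definition dom_gamma :: "'p domain_structure \<Rightarrow> 'p set \<Rightarrow> 'p set" where
  "dom_gamma \<A> C = GammaD \<A> (up_closure \<A> (dom_op \<A> ` C))"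

lemma full_proper_oda_D6:
  "dom_op (full_proper_oda U) (compose (full_proper_oda U) a b) =
   dom_op (full_proper_oda U)
     (compose (full_proper_oda U) a (dom_op (full_proper_oda U) b))"
  by (auto simp: full_proper_oda_def)

lemma GammaD_closed_full_iff:
  "GammaD_closed (full_proper_oda U) X \<longleftrightarrow>
     is_upset (full_proper_oda U) X \<and>
     (\<forall>x\<in>X. \<forall>y\<in>X. \<forall>z\<in>X. Id_on (Domain x) O y O Id_on (Range z) \<in> X)"
    (is "?L \<longleftrightarrow> ?R")
proof
  assume L: ?L
  have "Id_on (Domain x) O y O Id_on (Range z) \<in> X"
    if "x \<in> X" "y \<in> X" "z \<in> X" for x y z
  proof -
    have "X \<subseteq> Pow (U \<times> U)"
      using L by (simp add: GammaD_closed_def is_upset_def full_proper_oda_def)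
    then have "Id_on (Domain x) O y O Id_on (Range z) \<subseteq> U \<times> U"
      using that by fastforce
    then have "Id_on (Domain x) O y O Id_on (Range z) \<in> up_closure (full_proper_oda U)
       {compose (full_proper_oda U) (compose (full_proper_oda U)
           (dom_op (full_proper_oda U) x) y) (ran_op (full_proper_oda U) z) | x y z.
          x \<in> X \<and> y \<in> X \<and> z \<in> X}"
      using that by (auto simp: up_closure_def full_proper_oda_def O_assoc)
    then show ?thesis using L by (simp add: GammaD_closed_def)
  qed
  then show ?R using L by (simp add: GammaD_closed_def)
next
  assume R: ?R
  have id: "Id_on (Domain y) O y O Id_on (Range y) = y" for y :: "('a \<times> 'a) set"
    by auto
  show ?L
    unfolding GammaD_closed_def
  proof (intro conjI equalityI subsetI)
    show "is_upset (full_proper_oda U) X" using R by blast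
  next
    fix p
    assume "p \<in> up_closure (full_proper_oda U)
       {compose (full_proper_oda U) (compose (full_proper_oda U)
           (dom_op (full_proper_oda U) x) y) (ran_op (full_proper_oda U) z) | x y z.
          x \<in> X \<and> y \<in> X \<and> z \<in> X}"
    then obtain x y z where "x \<in> X" "y \<in> X" "z \<in> X" "p \<subseteq> U \<times> U"
      "Id_on (Domain x) O y O Id_on (Range z) \<subseteq> p"
      by (auto simp: up_closure_def full_proper_oda_def O_assoc)
    then show "p \<in> X" using R
      by (simp add: is_upset_def full_proper_oda_def) blast
  next
    fix p assume p: "p \<in> X"
    then have "p \<subseteq> U \<times> U" using R by (auto simp: is_upset_def full_proper_oda_def)
    then show "p \<in> up_closure (full_proper_oda U)
       {compose (full_proper_oda U) (compose (full_proper_oda U)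
           (dom_op (full_proper_oda U) x) y) (ran_op (full_proper_oda U) z) | x y z.
          x \<in> X \<and> y \<in> X \<and> z \<in> X}"
      using p id[of p]
      by (simp add: up_closure_def full_proper_oda_def O_assoc) (metis order_refl)
  qed
qed

lemma GammaD_closed_full_elems:
  "GammaD_closed (full_proper_oda U) (Pow (U \<times> U))"
  unfolding GammaD_closed_full_iff
  by (fastforce simp: is_upset_def full_proper_oda_def)

lemma GammaD_least_full:
  assumes "is_upset (full_proper_oda U) X"
  shows "GammaD_closed (full_proper_oda U) (GammaD (full_proper_oda U) X)"
    and "X \<subseteq> GammaD (full_proper_oda U) X"
    and "\<And>Y. GammaD_closed (full_proper_oda U) Y \<Longrightarrow> X \<subseteq> Y \<Longrightarrow>
           GammaD (full_proper_oda U) X \<subseteq> Y"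
proof -
  have sub: "X \<subseteq> Pow (U \<times> U)"
    using assms by (simp add: is_upset_def full_proper_oda_def)
  show "X \<subseteq> GammaD (full_proper_oda U) X"
    by (simp add: GammaD_def hull_subset)
  show "\<And>Y. GammaD_closed (full_proper_oda U) Y \<Longrightarrow> X \<subseteq> Y \<Longrightarrow>
           GammaD (full_proper_oda U) X \<subseteq> Y"
    by (simp add: GammaD_def hull_minimal)
  define F where "F = {Y. GammaD_closed (full_proper_oda U) Y \<and> X \<subseteq> Y}"
  have F1: "Pow (U \<times> U) \<in> F"
    using GammaD_closed_full_elems sub by (auto simp: F_def)
  have F2: "is_upset (full_proper_oda U) Y"
    "x \<in> Y \<Longrightarrow> y \<in> Y \<Longrightarrow> z \<in> Y \<Longrightarrow> Id_on (Domain x) O y O Id_on (Range z) \<in> Y"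
    if "Y \<in> F" for Y x y z
    using that by (auto simp: F_def GammaD_closed_full_iff)
  have "is_upset (full_proper_oda U) (\<Inter>F)"
    unfolding is_upset_def
  proof (intro conjI ballI impI)
    show "\<Inter>F \<subseteq> elems (full_proper_oda U)"
      using F1 by (auto simp: full_proper_oda_def)
  next
    fix x p
    assume "x \<in> \<Inter>F" "p \<in> elems (full_proper_oda U)" "leq (full_proper_oda U) x p"
    then show "p \<in> \<Inter>F"
      using F2(1) unfolding is_upset_def by blast
  qed
  then have "GammaD_closed (full_proper_oda U) (\<Inter>F)"
    unfolding GammaD_closed_full_iff using F2(2) by blast
  then show "GammaD_closed (full_proper_oda U) (GammaD (full_proper_oda U) X)"
    by (simp add: GammaD_def hull_def F_def)
qed

end

theory Submission
  imports Defs
begin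

text \<open>
  A closed up-set contains every restriction of a member to the domain of a second and the range of
  a third. Axiom (D6) breaks because \<open>\<^bold>dom\<close> forgets ranges, whereas \<open>\<Gamma>\<^sub>D\<close> can use the ranges
  occurring in \<open>A ;\<^sub>\<gamma> B\<close> to make relations smaller.

  Fix \<open>p \<noteq> q\<close> in \<open>U\<close>, let \<open>A\<close> consist of the relations containing \<open>(p, p)\<close>, and let \<open>B\<close> consist of the
  total surjective relations. Every restriction by members of \<open>B\<close> is trivial, so \<open>B\<close> is closed. After
  composition on the left with \<open>{(p, p)}\<close> the members of \<open>B\<close> can be told apart by their ranges:
  the identity yields \<open>{(p, p)}\<close>, with range \<open>{p}\<close>, while the diversity relation
  \<open>{(u, v). u \<noteq> v}\<close>, total and surjective as \<open>U\<close> has at least two elements, yields a relation whose range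
  omits \<open>p\<close>. Restricting the former to the range of the latter gives \<open>\<emptyset>\<close>, so the left-hand side of (D6)
  contains \<open>\<emptyset>\<close>. On the right, all members of \<open>B\<close> have domain \<open>U\<close>; hence \<open>\<^bold>dom\<^sub>\<gamma> B\<close> is just the
  principal up-set of the identity, composition with which leaves \<open>A\<close> fixed, and
  \<open>\<^bold>dom\<^sub>\<gamma> A \<subseteq> A\<close> does not contain \<open>\<emptyset>\<close>.
\<close>

lemma GammaD_up_closure_subset:
  assumes Y: "GammaD_closed \<A> Y" and S: "S \<subseteq> Y"
  shows "GammaD \<A> (up_closure \<A> S) \<subseteq> Y"
proof -
  have "is_upset \<A> Y"
    using Y by (simp add: GammaD_closed_def)
  then have "up_closure \<A> S \<subseteq> Y"
    using S unfolding up_closure_def is_upset_def by blast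
  then show ?thesis
    using Y by (simp add: GammaD_def hull_minimal)
qed

lemma subset_GammaD: "X \<subseteq> GammaD \<A> X"
  by (simp add: GammaD_def hull_subset)

text \<open>Restricting relations that all contain \<open>r\<close> by each other's domains and ranges
  never removes a pair of \<open>r\<close>.\<close>

lemma GammaD_closed_principal:
  "GammaD_closed (full_proper_oda U) {s \<in> Pow (U \<times> U). r \<subseteq> s}"
  unfolding GammaD_closed_full_iff
  by (fastforce simp: is_upset_def full_proper_oda_def)

lemma GammaD_closed_total_surjective:
  "GammaD_closed (full_proper_oda U) {s \<in> Pow (U \<times> U). Domain s = U \<and> Range s = U}"
proof -
  have "Id_on U O s O Id_on U = s" if "s \<subseteq> U \<times> U" for s :: "('a \<times> 'a) set"
    using that by auto
  moreover have "Domain t = U \<and> Range t = U"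
    if "s \<subseteq> t" "t \<subseteq> U \<times> U" "Domain s = U" "Range s = U" for s t :: "('a \<times> 'a) set"
    using that by blast
  ultimately show ?thesis
    unfolding GammaD_closed_full_iff by (auto simp: is_upset_def full_proper_oda_def)
qed

text \<open>Two members \<open>r\<close> and \<open>s\<close> with disjoint ranges already put \<open>\<emptyset>\<close> into the closure:
  cutting \<open>r\<close> down to the range of \<open>s\<close> leaves nothing.\<close>

lemma empty_mem_GammaD:
  assumes "r \<in> X" "s \<in> X" "Range r \<inter> Range s = {}"
  shows "{} \<in> GammaD (full_proper_oda U) X"
  unfolding GammaD_def hull_def
proof (rule InterI, clarify)
  fix Y assume Y: "GammaD_closed (full_proper_oda U) Y" "X \<subseteq> Y"
  then have "Id_on (Domain r) O r O Id_on (Range s) \<in> Y"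
    using assms(1,2) unfolding GammaD_closed_full_iff by blast
  moreover have "Id_on (Domain r) O r O Id_on (Range s) = {}"
    using assms(3) by blast
  ultimately show "{} \<in> Y" by simp
qed

lemma compose_mem_up_closure:
  assumes "a \<in> A" "b \<in> B" "a \<subseteq> U \<times> U" "b \<subseteq> U \<times> U"
  shows "a O b \<in> up_closure (full_proper_oda U)
           {compose (full_proper_oda U) c d | c d. c \<in> A \<and> d \<in> B}"
proof -
  have "a O b \<subseteq> U \<times> U" using assms(3,4) by auto
  then show ?thesis
    using assms(1,2) by (auto simp: up_closure_def full_proper_oda_def)
qed

lemma D6_fails_in_completion:
  fixes U :: "'u set"
  assumes "p \<in> U" "q \<in> U" "p \<noteq> q"
  defines "\<A> \<equiv> full_proper_oda U"
  shows "\<exists>A \<in> completion \<A>. \<exists>B \<in> completion \<A>.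
           dom_gamma \<A> (comp_gamma \<A> A B) \<noteq>
           dom_gamma \<A> (comp_gamma \<A> A (dom_gamma \<A> B))"
proof -
  define A where "A = {s \<in> Pow (U \<times> U). {(p, p)} \<subseteq> s}"
  define B where "B = {s \<in> Pow (U \<times> U). Domain s = U \<and> Range s = U}"
  define E where "E = {s \<in> Pow (U \<times> U). Id_on U \<subseteq> s}"
  have A: "GammaD_closed \<A> A" and B: "GammaD_closed \<A> B" and E: "GammaD_closed \<A> E"
    unfolding A_def B_def E_def \<A>_def
    by (rule GammaD_closed_principal GammaD_closed_total_surjective)+

  define D where "D = {(u, v). u \<in> U \<and> v \<in> U \<and> u \<noteq> v}"
  have "{(p, p)} \<in> A" "Id_on U \<in> B" "D \<in> B"
    using assms(1-3) by (auto simp: A_def B_def D_def)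
  then have
    "{(p, p)} O Id_on U \<in> up_closure \<A> {compose \<A> c d | c d. c \<in> A \<and> d \<in> B}"
    "{(p, p)} O D \<in> up_closure \<A> {compose \<A> c d | c d. c \<in> A \<and> d \<in> B}"
    using assms(1) unfolding \<A>_def by (auto intro!: compose_mem_up_closure simp: D_def)
  moreover have "Range ({(p, p)} O Id_on U) \<inter> Range ({(p, p)} O D) = {}"
    by (auto simp: D_def)
  ultimately have "{} \<in> comp_gamma \<A> A B"
    unfolding comp_gamma_def \<A>_def by (rule empty_mem_GammaD)
  then have "{} \<in> dom_op \<A> ` comp_gamma \<A> A B"
    by (rule rev_image_eqI) (simp add: \<A>_def full_proper_oda_def)
  moreover have "{} \<in> elems \<A>" "leq \<A> {} {}"
    by (simp_all add: \<A>_def full_proper_oda_def)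
  ultimately have "{} \<in> up_closure \<A> (dom_op \<A> ` comp_gamma \<A> A B)"
    unfolding up_closure_def by blast
  then have left: "{} \<in> dom_gamma \<A> (comp_gamma \<A> A B)"
    unfolding dom_gamma_def by (rule subsetD[OF subset_GammaD])

  have ops: "compose \<A> = (O)" "dom_op \<A> = (\<lambda>x. Id_on (Domain x))"
    by (simp_all add: \<A>_def full_proper_oda_def)
  have "Id_on (Domain b) \<in> E" if "b \<in> B" for b
    using that by (auto simp: B_def E_def)
  then have "dom_gamma \<A> B \<subseteq> E"
    unfolding dom_gamma_def ops by (intro GammaD_up_closure_subset[OF E]) blast
  moreover have "a O e \<in> A" if "a \<in> A" "e \<in> E" for a e
  proof -
    have "(p, p) \<in> a O e"
      using that assms(1) unfolding A_def E_def by blast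
    moreover have "a O e \<subseteq> U \<times> U"
      using that unfolding A_def E_def by blast
    ultimately show ?thesis by (simp add: A_def)
  qed
  ultimately have comp: "comp_gamma \<A> A (dom_gamma \<A> B) \<subseteq> A"
    unfolding comp_gamma_def ops by (intro GammaD_up_closure_subset[OF A]) blast
  have "Id_on (Domain a) \<in> A" if "a \<in> A" for a
    using that unfolding A_def by blast
  with comp have "dom_gamma \<A> (comp_gamma \<A> A (dom_gamma \<A> B)) \<subseteq> A"
    unfolding dom_gamma_def[of _ "comp_gamma _ _ _"] ops
    by (intro GammaD_up_closure_subset[OF A]) blast
  moreover have "{} \<notin> A"
    by (simp add: A_def)
  ultimately have
    "dom_gamma \<A> (comp_gamma \<A> A B) \<noteq> dom_gamma \<A> (comp_gamma \<A> A (dom_gamma \<A> B))"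
    using left by (metis subsetD)
  moreover have "A \<in> completion \<A>" "B \<in> completion \<A>"
    using A B by (simp_all add: completion_def)
  ultimately show ?thesis by (intro bexI)
qed

theorem mainTheorem4:
  fixes U :: "'u set"
  assumes "card U = 2"
  shows "\<exists>A \<in> completion (full_proper_oda U). \<exists>B \<in> completion (full_proper_oda U).
           dom_gamma (full_proper_oda U) (comp_gamma (full_proper_oda U) A B) \<noteq>
           dom_gamma (full_proper_oda U)
             (comp_gamma (full_proper_oda U) A (dom_gamma (full_proper_oda U) B))"
proof -
  obtain p q where "p \<in> U" "q \<in> U" "p \<noteq> q"
    using assms by (auto simp: card_2_iff)
  then show ?thesis by (rule D6_fails_in_completion)
qed

end
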